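(* For any $\varepsilon\in(0,1/2)$ there exist $\alpha\in(0,1)$ and a constant $K<\infty$ such that for all $k\in\mathbb{N}$ the natural identity bijection of the vertex set of the weighted diamond $W_k$ (with parameter $\varepsilon$ and metric $d_{W_k}$) onto the vertex set of $D_k$ endowed with the $\alpha$-snowflaked metric $d_{D_k}^{\alpha}$ has distortion at most $K$.
   Context: Diamond graphs $\{D_n\}_{n\ge0}$: $D_0$ consists of two vertices joined by an edge; $D_n$ is obtained from $D_{n-1}$ by replacing each edge $uv$ of $D_{n-1}$ by a quadrilateral $u,a,v,b$ with two new vertices $a,b$ and edges $ua, av, vb, bu$. The metric $d_{D_k}$ on the vertex set of $D_k$ is the shortest path distance when each edge of $D_k$ has length $\left(\frac12\right)^k$. Weighted diamonds: for $\varepsilon\in(0,\frac12)$, $W_n$ is the weighted graph whose vertex set is the vertex set of $D_n$ and whose edge set is the union of the edge sets of $D_0,\dots,D_n$, where each edge of $D_i$ has weight $\left(\frac12+\varepsilon\right)^i$; $d_{W_n}$ is its weighted shortest path distance. For a metric space $(X,d_X)$ and $0<\alpha<1$, the $\alpha$-snowflaked version of $(X,d_X)$ is $X$ with the metric $(d_X(u,v))^\alpha$. The distortion of an injective map $f:X\to Y$ between metric spaces is $\sup_{x\ne y}\frac{d_Y(f(x),f(y))}{d_X(x,y)}\cdot\sup_{x\ne y}\frac{d_X(x,y)}{d_Y(f(x),f(y))}$. *)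

theory Defs
  imports
    "HOL-Analysis.Analysis"
    "Graph_Theory.Digraph_Component"
    "Graph_Theory.Shortest_Path"
begin

section \<open>Diamond graphs\<close>

text \<open>
  \<open>Mid u v b\<close>, for the two values of \<open>b\<close>, names the two vertices created when the edge
  between \<open>u\<close> and \<open>v\<close> is replaced by a quadrilateral.  With these names the vertex set of
  each diamond graph literally contains that of the preceding one.
\<close>

datatype dvertex = Source | Sink | Mid dvertex dvertex bool

text \<open>
  Every undirected edge is listed exactly once, oriented from \<open>Source\<close> towards \<open>Sink\<close>, so that
  \<open>Mid u v b\<close> is determined by the edge.  The graphs themselves are undirected: they are obtained
  by adding all reversed arcs.
\<close>

primrec diamond_edges :: "nat \<Rightarrow> (dvertex \<times> dvertex) set" where
  "diamond_edges 0 = {(Source, Sink)}"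
| "diamond_edges (Suc n) =
     (\<Union>(u, v)\<in>diamond_edges n. \<Union>b. {(u, Mid u v b), (Mid u v b, v)})"

primrec diamond_verts :: "nat \<Rightarrow> dvertex set" where
  "diamond_verts 0 = {Source, Sink}"
| "diamond_verts (Suc n) =
     diamond_verts n \<union> {Mid u v b | u v b. (u, v) \<in> diamond_edges n}"

definition diamond :: "nat \<Rightarrow> dvertex pair_pre_digraph" where
  "diamond n = mk_symmetric (with_proj \<lparr>pverts = diamond_verts n, parcs = diamond_edges n\<rparr>)"

definition weighted_diamond :: "nat \<Rightarrow> dvertex pair_pre_digraph" where
  "weighted_diamond n =
     mk_symmetric (with_proj \<lparr>pverts = diamond_verts n, parcs = (\<Union>i\<le>n. diamond_edges i)\<rparr>)"

text \<open>
  The index of the unique diamond graph having the given edge; see \<open>edge_level_eq\<close> below.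
\<close>

definition edge_level :: "dvertex \<times> dvertex \<Rightarrow> nat" where
  "edge_level e = (THE i. e \<in> parcs (diamond i))"

section \<open>Metrics and distortion\<close>

text \<open>
  The shortest path distance of the library is extended real valued (infinite between
  different components); all graphs considered here are finite and connected.
\<close>

definition graph_dist ::
  "'a pair_pre_digraph \<Rightarrow> ('a \<times> 'a \<Rightarrow> real) \<Rightarrow> 'a \<Rightarrow> 'a \<Rightarrow> real" where
  "graph_dist G w u v = real_of_ereal (wf_digraph.\<mu> (with_proj G) w u v)"

definition diamond_dist :: "nat \<Rightarrow> dvertex \<Rightarrow> dvertex \<Rightarrow> real" where
  "diamond_dist n = graph_dist (diamond n) (\<lambda>_. (1/2) ^ n)"

definition weighted_diamond_dist :: "real \<Rightarrow> nat \<Rightarrow> dvertex \<Rightarrow> dvertex \<Rightarrow> real" where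
  "weighted_diamond_dist \<epsilon> n =
     graph_dist (weighted_diamond n) (\<lambda>e. (1/2 + \<epsilon>) ^ edge_level e)"

definition snowflake :: "real \<Rightarrow> ('a \<Rightarrow> 'a \<Rightarrow> real) \<Rightarrow> 'a \<Rightarrow> 'a \<Rightarrow> real" where
  "snowflake \<alpha> d u v = d u v powr \<alpha>"

definition distortion ::
  "'a set \<Rightarrow> ('a \<Rightarrow> 'a \<Rightarrow> real) \<Rightarrow> ('b \<Rightarrow> 'b \<Rightarrow> real) \<Rightarrow> ('a \<Rightarrow> 'b) \<Rightarrow> ennreal" where
  "distortion X dX dY f =
     (SUP (x, y)\<in>{(x, y). x \<in> X \<and> y \<in> X \<and> x \<noteq> y}.
        ennreal (dY (f x) (f y)) / ennreal (dX x y)) *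
     (SUP (x, y)\<in>{(x, y). x \<in> X \<and> y \<in> X \<and> x \<noteq> y}.
        ennreal (dX x y) / ennreal (dY (f x) (f y)))"

section \<open>Well-formedness\<close>

lemma diamond_verts_mono: "m \<le> n \<Longrightarrow> diamond_verts m \<subseteq> diamond_verts n"
  by (rule lift_Suc_mono_le[of diamond_verts]) auto

lemma diamond_edges_verts:
  "(u, v) \<in> diamond_edges n \<Longrightarrow> u \<in> diamond_verts n \<and> v \<in> diamond_verts n"
proof (induction n arbitrary: u v)
  case (Suc n)
  from Suc.prems obtain x y b where "(x, y) \<in> diamond_edges n"
    and "(u, v) = (x, Mid x y b) \<or> (u, v) = (Mid x y b, y)"
    by auto
  with Suc.IH[of x y] show ?case by auto
qed simp

lemma pverts_diamond [simp]: "pverts (diamond n) = diamond_verts n"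
  by (simp add: diamond_def)

lemma pverts_weighted_diamond [simp]: "pverts (weighted_diamond n) = diamond_verts n"
  by (simp add: weighted_diamond_def)

lemma parcs_diamond:
  "(u, v) \<in> parcs (diamond n) \<longleftrightarrow> (u, v) \<in> diamond_edges n \<or> (v, u) \<in> diamond_edges n"
  unfolding diamond_def parcs_mk_symmetric by (auto intro: bexI[of _ "(v, u)"])

lemma parcs_weighted_diamond: "parcs (weighted_diamond n) = (\<Union>i\<le>n. parcs (diamond i))"
  by (auto simp: weighted_diamond_def diamond_def parcs_mk_symmetric)

lemma pair_wf_digraph_diamond: "pair_wf_digraph (diamond n)"
  by unfold_locales (auto simp: parcs_diamond dest: diamond_edges_verts)

lemma pair_wf_digraph_weighted_diamond: "pair_wf_digraph (weighted_diamond n)"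
proof -
  have "u \<in> diamond_verts n \<and> v \<in> diamond_verts n"
    if "(u, v) \<in> parcs (weighted_diamond n)" for u v
    using that diamond_verts_mono
    by (fastforce simp: parcs_weighted_diamond parcs_diamond dest: diamond_edges_verts)
  then show ?thesis by unfold_locales auto
qed

primrec vertex_level :: "dvertex \<Rightarrow> nat" where
  "vertex_level Source = 0"
| "vertex_level Sink = 0"
| "vertex_level (Mid u v b) = Suc (max (vertex_level u) (vertex_level v))"

lemma diamond_edges_level:
  "(u, v) \<in> diamond_edges n \<Longrightarrow> max (vertex_level u) (vertex_level v) = n"
proof (induction n arbitrary: u v)
  case (Suc n)
  from Suc.prems obtain x y b where "(x, y) \<in> diamond_edges n"
    and "(u, v) = (x, Mid x y b) \<or> (u, v) = (Mid x y b, y)"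
    by auto
  with Suc.IH[of x y] show ?case by auto
qed simp

lemma diamond_verts_level: "v \<in> diamond_verts n \<Longrightarrow> vertex_level v \<le> n"
  by (induction n) (auto dest: diamond_edges_level)

lemma Mid_fresh: "(u, v) \<in> diamond_edges n \<Longrightarrow> Mid u v b \<notin> diamond_verts n"
  using diamond_edges_level diamond_verts_level by fastforce

lemma diamond_edges_oriented: "(u, v) \<in> diamond_edges n \<Longrightarrow> (v, u) \<notin> diamond_edges n"
proof (induction n arbitrary: u v)
  case (Suc n)
  have "(x, x) \<notin> diamond_edges n" for x
    using Suc.IH by blast
  moreover have "Mid x y b \<noteq> x" "Mid x y b \<noteq> y" for x y b
    by (metis lessI less_irrefl max.strict_coboundedI1 max.strict_coboundedI2
        not_less_eq vertex_level.simps(3))+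
  moreover have "x \<noteq> Mid (Mid x y b) z c" "x \<noteq> Mid z (Mid y x b) c" for x y z b c
    by (auto dest!: arg_cong[where f = vertex_level])
  ultimately show ?case
    using Suc.prems by auto
qed simp

lemma parcs_diamond_level:
  "(u, v) \<in> parcs (diamond n) \<Longrightarrow> max (vertex_level u) (vertex_level v) = n"
  by (metis diamond_edges_level max.commute parcs_diamond)

lemma edge_level_eq: "e \<in> parcs (diamond i) \<Longrightarrow> edge_level e = i"
  unfolding edge_level_def
  by (metis parcs_diamond_level surj_pair the_equality)

end

theory Submission
  imports Defs
begin

text \<open>
  Put \<open>q = 1/2 + \<epsilon>\<close> and choose \<open>\<alpha>\<close> with \<open>q = (1/2) powr \<alpha>\<close>; as \<open>1/2 < q < 1\<close>, this exponent lies
  strictly between 0 and 1.  Then every level-\<open>i\<close> edge, whose endpoints are at distance \<open>(1/2) ^ i\<close>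
  in the diamond, has weight exactly the \<open>\<alpha>\<close>-th power of that distance.  The identity therefore
  satisfies \<open>e \<le> d \<le> C * e\<close>, where \<open>d\<close> is the weighted distance, \<open>e\<close> the snowflaked
  distance and \<open>C = 3 + 2 / (1 - q)\<close> is independent of \<open>k\<close>.

  Lower bound (\<open>snowflake_lower\<close>).  Since \<open>t powr \<alpha>\<close> is subadditive, the snowflaked distance obeys
  the triangle inequality.  So a walk in the weighted diamond, each of whose arcs costs at least the
  snowflaked distance it covers, costs at least the snowflaked distance of its endpoints.

  Upper bound (\<open>weighted_walk_upper\<close>).  Let \<open>x\<close> and \<open>y\<close> be at distance \<open>t\<close> with
  \<open>(1/2) ^ n \<le> t < 2 * (1/2) ^ n\<close>.  Descending one level at a time leads from \<open>x\<close> and from \<open>y\<close> to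
  vertices \<open>x'\<close> and \<open>y'\<close> of the \<open>n\<close>-th diamond, over diamond distance less than \<open>(1/2) ^ n\<close> and,
  by a geometric series, at weighted cost at most \<open>q ^ n / (1 - q)\<close> (\<open>ancestor_vertex\<close>).  Hence
  \<open>x'\<close> and \<open>y'\<close> are less than \<open>4 * (1/2) ^ n\<close> apart.  The \<open>n\<close>-th diamond is isometrically embedded
  in the finer ones (\<open>relpow_diamond_fold\<close>), so at most three of its edges join \<open>x'\<close> to \<open>y'\<close>.
  Altogether the weighted distance is at most \<open>C * q ^ n\<close>, which is at most \<open>C * t powr \<alpha>\<close>.
\<close>

section \<open>Walks of a given cost\<close>

text \<open>
  Forgetting the list of arcs and keeping only the total cost gives one notion for both
  graphs: for a constant weight it is the relation power (\<open>cost_walk_const\<close>), which suits the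
  combinatorics of the diamonds, and it determines the shortest path distance
  (\<open>mu_eq_Inf_cost_walk\<close>).
\<close>

inductive cost_walk :: "('a \<times> 'a) set \<Rightarrow> ('a \<times> 'a \<Rightarrow> real) \<Rightarrow> real \<Rightarrow> 'a \<Rightarrow> 'a \<Rightarrow> bool"
  for A w where
  cost_walk_Nil: "cost_walk A w 0 x x"
| cost_walk_Cons: "(x, y) \<in> A \<Longrightarrow> cost_walk A w c y z \<Longrightarrow> cost_walk A w (w (x, y) + c) x z"

lemma cost_walk_arc: "(x, y) \<in> A \<Longrightarrow> cost_walk A w (w (x, y)) x y"
  using cost_walk_Cons[OF _ cost_walk_Nil] by fastforce

lemma cost_walk_trans:
  "cost_walk A w c x y \<Longrightarrow> cost_walk A w d y z \<Longrightarrow> cost_walk A w (c + d) x z"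
  by (induction rule: cost_walk.induct) (auto simp: add.assoc intro: cost_walk_Cons)

lemma cost_walk_sym:
  assumes "cost_walk A w c x y"
    and "\<And>u v. (u, v) \<in> A \<Longrightarrow> (v, u) \<in> A \<and> w (v, u) = w (u, v)"
  shows "cost_walk A w c y x"
  using assms(1)
proof (induction rule: cost_walk.induct)
  case (cost_walk_Cons x y c z)
  then have "cost_walk A w (c + w (y, x)) z x"
    using assms(2) by (blast intro: cost_walk_trans cost_walk_arc)
  then show ?case
    using assms(2)[OF cost_walk_Cons.hyps(1)] by (simp add: add.commute)
qed (rule cost_walk_Nil)

lemma cost_walk_mono: "cost_walk A w c x y \<Longrightarrow> A \<subseteq> B \<Longrightarrow> cost_walk B w c x y"
  by (induction rule: cost_walk.induct) (auto intro: cost_walk.intros)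

lemma cost_walk_nonneg:
  "cost_walk A w c x y \<Longrightarrow> (\<And>e. e \<in> A \<Longrightarrow> 0 \<le> w e) \<Longrightarrow> 0 \<le> c"
  by (induction rule: cost_walk.induct) auto

lemma cost_walk_const:
  "cost_walk A (\<lambda>_. s) c x y \<longleftrightarrow> (\<exists>n. (x, y) \<in> A ^^ n \<and> c = real n * s)"
proof
  show "cost_walk A (\<lambda>_. s) c x y \<Longrightarrow> \<exists>n. (x, y) \<in> A ^^ n \<and> c = real n * s"
  proof (induction rule: cost_walk.induct)
    case (cost_walk_Cons x y c z)
    then obtain n where "(y, z) \<in> A ^^ n" "c = real n * s"
      by blast
    with cost_walk_Cons.hyps(1) show ?case
      by (intro exI[of _ "Suc n"]) (auto simp: algebra_simps intro: relpow_Suc_I2 simp del: relpow.simps)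
  qed (auto intro: exI[of _ 0])
  have "(x, y) \<in> A ^^ n \<Longrightarrow> cost_walk A (\<lambda>_. s) (real n * s) x y" for n
  proof (induction n arbitrary: y)
    case (Suc n)
    then obtain z where "(x, z) \<in> A ^^ n" "(z, y) \<in> A"
      by auto
    then have "cost_walk A (\<lambda>_. s) (real n * s + s) x y"
      using Suc.IH cost_walk_arc[of z y A "\<lambda>_. s"] cost_walk_trans by fast
    then show ?case
      by (simp add: algebra_simps)
  qed (auto intro: cost_walk_Nil)
  then show "\<exists>n. (x, y) \<in> A ^^ n \<and> c = real n * s \<Longrightarrow> cost_walk A (\<lambda>_. s) c x y"
    by blast
qed

lemma relpow_sym: "sym R \<Longrightarrow> (x, y) \<in> R ^^ n \<Longrightarrow> (y, x) \<in> R ^^ n"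
proof (induction n arbitrary: y)
  case (Suc n)
  then obtain z where "(x, z) \<in> R ^^ n" "(y, z) \<in> R"
    by (auto dest: symD)
  with Suc show ?case
    by (blast intro: relpow_Suc_I2)
qed simp

section \<open>Shortest path distances\<close>

context pair_wf_digraph
begin

lemma cost_walk_iff_awalk:
  assumes "u \<in> pverts G"
  shows "cost_walk (parcs G) w c u v \<longleftrightarrow> (\<exists>p. awalk u p v \<and> awalk_cost w p = c)"
proof
  show "\<exists>p. awalk u p v \<and> awalk_cost w p = c" if "cost_walk (parcs G) w c u v"
    using that assms
  proof (induction rule: cost_walk.induct)
    case (cost_walk_Nil x)
    then show ?case
      by (intro exI[of _ "[]"]) (simp add: awalk_Nil_iff)
  next
    case (cost_walk_Cons x y c z)
    then obtain p where "awalk y p z" "awalk_cost w p = c"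
      using in_arcsD2 by blast
    with cost_walk_Cons show ?case
      by (intro exI[of _ "(x, y) # p"]) (simp add: awalk_Cons_iff)
  qed
  have "awalk u p v \<Longrightarrow> cost_walk (parcs G) w (awalk_cost w p) u v" for p
  proof (induction p arbitrary: u)
    case Nil
    then show ?case
      by (simp add: awalk_Nil_iff cost_walk_Nil)
  next
    case (Cons e p)
    then show ?case
      by (cases e) (auto simp: awalk_Cons_iff intro: cost_walk_Cons)
  qed
  then show "\<exists>p. awalk u p v \<and> awalk_cost w p = c \<Longrightarrow> cost_walk (parcs G) w c u v"
    by blast
qed

lemma mu_eq_Inf_cost_walk:
  assumes "u \<in> pverts G"
  shows "\<mu> w u v = (INF c\<in>{c. cost_walk (parcs G) w c u v}. ereal c)"
  unfolding \<mu>_def cost_walk_iff_awalk[OF assms]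
  by (rule arg_cong[where f = Inf]) auto

text \<open>
  The existence of some walk matters here: otherwise the infimum is infinite and
  \<open>real_of_ereal\<close> sends it to 0.  In the dual lemma below, nonnegative weights exclude
  the value minus infinity.
\<close>

lemma graph_dist_greatest:
  assumes u: "u \<in> pverts G" and walk: "cost_walk (parcs G) w d u v"
    and lower: "\<And>c. cost_walk (parcs G) w c u v \<Longrightarrow> b \<le> c"
  shows "b \<le> graph_dist G w u v"
proof -
  have "ereal b \<le> \<mu> w u v"
    unfolding mu_eq_Inf_cost_walk[OF u] by (rule INF_greatest) (auto intro: lower)
  moreover have "\<mu> w u v \<le> ereal d"
    unfolding mu_eq_Inf_cost_walk[OF u] by (rule INF_lower) (use walk in simp)
  ultimately show ?thesis
    unfolding graph_dist_def by (cases "\<mu> w u v") auto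
qed

lemma graph_dist_lower:
  assumes u: "u \<in> pverts G" and walk: "cost_walk (parcs G) w c u v"
    and nonneg: "\<And>e. e \<in> parcs G \<Longrightarrow> 0 \<le> w e"
  shows "graph_dist G w u v \<le> c"
proof -
  have "ereal 0 \<le> \<mu> w u v"
    unfolding mu_eq_Inf_cost_walk[OF u]
    by (rule INF_greatest) (auto intro: cost_walk_nonneg nonneg)
  moreover have "\<mu> w u v \<le> ereal c"
    unfolding mu_eq_Inf_cost_walk[OF u] by (rule INF_lower) (use walk in simp)
  ultimately show ?thesis
    unfolding graph_dist_def by (cases "\<mu> w u v") auto
qed

end

section \<open>Walks in diamond graphs\<close>

lemma sym_parcs_diamond: "sym (parcs (diamond n))"
  by (auto simp: sym_def parcs_diamond)

lemma parcs_diamond_Suc_cases: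
  assumes "(x, y) \<in> parcs (diamond (Suc n))"
  obtains u v b where "(u, v) \<in> diamond_edges n" "x = Mid u v b" "y \<in> {u, v}"
  | u v b where "(u, v) \<in> diamond_edges n" "y = Mid u v b" "x \<in> {u, v}"
  using assms by (auto simp: parcs_diamond)

lemma diamond_edges_Mid:
  assumes "(u, v) \<in> diamond_edges n"
  shows "(u, Mid u v b) \<in> diamond_edges (Suc n)" "(Mid u v b, v) \<in> diamond_edges (Suc n)"
  using assms by (simp, blast)+

lemma parcs_diamond_subdivide:
  assumes "(u, v) \<in> parcs (diamond n)"
  obtains m where "(u, m) \<in> parcs (diamond (Suc n))" "(m, v) \<in> parcs (diamond (Suc n))"
  using assms diamond_edges_Mid unfolding parcs_diamond by meson

lemma relpow_diamond_refine:
  "(x, y) \<in> parcs (diamond n) ^^ h \<Longrightarrow> (x, y) \<in> parcs (diamond (n + j)) ^^ (2 ^ j * h)"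
proof (induction j)
  case (Suc j)
  have "(x, y) \<in> parcs (diamond m) ^^ l \<Longrightarrow> (x, y) \<in> parcs (diamond (Suc m)) ^^ (2 * l)" for l m
  proof (induction l arbitrary: y)
    case (Suc l)
    then obtain z where z: "(x, z) \<in> parcs (diamond (Suc m)) ^^ (2 * l)" "(z, y) \<in> parcs (diamond m)"
      by auto
    from z(2) obtain z' where "(z, z') \<in> parcs (diamond (Suc m))" "(z', y) \<in> parcs (diamond (Suc m))"
      by (rule parcs_diamond_subdivide)
    with z(1) have "(x, y) \<in> parcs (diamond (Suc m)) ^^ Suc (Suc (2 * l))"
      by (intro relpow_Suc_I)
    then show ?case
      by simp
  qed simp
  from this[OF Suc.IH[OF Suc.prems]] show ?case
    by (simp add: mult.assoc)
qed simp

text \<open>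
  Every arc of the diamond of level \<open>n + 1\<close> joins a new vertex to an old one, and the only neighbours
  of the new vertex \<open>Mid u v b\<close> are \<open>u\<close> and \<open>v\<close>.  A walk between old vertices thus splits into
  pairs of arcs, each of which either returns to its starting point or crosses one edge
  of the coarser diamond.
\<close>

lemma relpow_diamond_fold_Suc:
  assumes "(x, y) \<in> parcs (diamond (Suc n)) ^^ h"
    and "x \<in> diamond_verts n" "y \<in> diamond_verts n"
  shows "\<exists>l. 2 * l \<le> h \<and> (x, y) \<in> parcs (diamond n) ^^ l"
  using assms
proof (induction h arbitrary: x rule: less_induct)
  case (less h)
  show ?case
  proof (cases h)
    case 0
    with less.prems show ?thesis
      by (intro exI[of _ 0]) auto
  next
    case (Suc h')
    then obtain m where xm: "(x, m) \<in> parcs (diamond (Suc n))"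
      and my: "(m, y) \<in> parcs (diamond (Suc n)) ^^ h'"
      using less.prems(1) relpow_Suc_D2 by metis
    from xm obtain u v b where uv: "(u, v) \<in> diamond_edges n" and m: "m = Mid u v b"
      and x: "x \<in> {u, v}"
      using less.prems(2) Mid_fresh by (cases rule: parcs_diamond_Suc_cases) blast+
    have m_new: "m \<notin> diamond_verts n"
      using Mid_fresh[OF uv] m by simp
    with my less.prems(3) obtain h'' where h': "h' = Suc h''"
      by (cases h') auto
    with my obtain z where mz: "(m, z) \<in> parcs (diamond (Suc n))"
      and zy: "(z, y) \<in> parcs (diamond (Suc n)) ^^ h''"
      using relpow_Suc_D2 by metis
    have z: "z \<in> {u, v}"
      using mz
    proof (cases rule: parcs_diamond_Suc_cases)
      case 1
      then show ?thesis
        using m by simp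
    next
      case 2
      then show ?thesis
        using m_new diamond_edges_verts by blast
    qed
    then have "z \<in> diamond_verts n"
      using diamond_edges_verts[OF uv] by blast
    then obtain l where l: "2 * l \<le> h''" "(z, y) \<in> parcs (diamond n) ^^ l"
      using less.IH[of h'' z] zy less.prems(3) Suc h' by auto
    have "x = z \<or> (x, z) \<in> parcs (diamond n)"
      using x z uv by (auto simp: parcs_diamond)
    then show ?thesis
    proof
      assume "x = z"
      with l Suc h' show ?thesis
        by (intro exI[of _ l]) simp
    next
      assume "(x, z) \<in> parcs (diamond n)"
      with l Suc h' show ?thesis
        by (intro exI[of _ "Suc l"]) (auto intro: relpow_Suc_I2 simp del: relpow.simps)
    qed
  qed
qed

lemma relpow_diamond_fold:
  assumes "(x, y) \<in> parcs (diamond (n + j)) ^^ h"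
    and "x \<in> diamond_verts n" "y \<in> diamond_verts n"
  shows "\<exists>l. 2 ^ j * l \<le> h \<and> (x, y) \<in> parcs (diamond n) ^^ l"
  using assms(1)
proof (induction j arbitrary: h)
  case 0
  then show ?case
    by auto
next
  case (Suc j)
  have "x \<in> diamond_verts (n + j)" "y \<in> diamond_verts (n + j)"
    using assms diamond_verts_mono[of n "n + j"] by auto
  then obtain l where l: "2 * l \<le> h" "(x, y) \<in> parcs (diamond (n + j)) ^^ l"
    using relpow_diamond_fold_Suc Suc.prems by (metis add_Suc_right)
  then obtain l' where "2 ^ j * l' \<le> l" "(x, y) \<in> parcs (diamond n) ^^ l'"
    using Suc.IH by blast
  with l show ?case
    by (intro exI[of _ l']) auto
qed

section \<open>Weighted diamonds\<close>

definition weighted_walk :: "real \<Rightarrow> nat \<Rightarrow> real \<Rightarrow> dvertex \<Rightarrow> dvertex \<Rightarrow> bool" where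
  "weighted_walk q k = cost_walk (parcs (weighted_diamond k)) (\<lambda>e. q ^ edge_level e)"

lemma weighted_walk_trans:
  "weighted_walk q k c x y \<Longrightarrow> weighted_walk q k d y z \<Longrightarrow> weighted_walk q k (c + d) x z"
  unfolding weighted_walk_def by (rule cost_walk_trans)

lemma weighted_walk_mono: "weighted_walk q k c x y \<Longrightarrow> k \<le> k' \<Longrightarrow> weighted_walk q k' c x y"
  unfolding weighted_walk_def parcs_weighted_diamond
  by (erule cost_walk_mono) (rule UN_mono, simp_all)

lemma weighted_walk_arc:
  assumes "(x, y) \<in> parcs (diamond i)" "i \<le> k"
  shows "weighted_walk q k (q ^ i) x y"
  using cost_walk_arc[of x y "parcs (weighted_diamond k)" "\<lambda>e. q ^ edge_level e"] assms
  by (auto simp: weighted_walk_def parcs_weighted_diamond edge_level_eq)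

lemma weighted_walk_sym: "weighted_walk q k c x y \<Longrightarrow> weighted_walk q k c y x"
  unfolding weighted_walk_def
proof (erule cost_walk_sym)
  fix u v
  assume "(u, v) \<in> parcs (weighted_diamond k)"
  then obtain i where i: "i \<le> k" "(u, v) \<in> parcs (diamond i)" "(v, u) \<in> parcs (diamond i)"
    using sym_parcs_diamond by (auto simp: parcs_weighted_diamond dest: symD)
  then show "(v, u) \<in> parcs (weighted_diamond k) \<and> q ^ edge_level (v, u) = q ^ edge_level (u, v)"
    by (auto simp: parcs_weighted_diamond edge_level_eq)
qed

lemma weighted_walk_relpow:
  assumes "(x, y) \<in> parcs (diamond i) ^^ l" "i \<le> k"
  shows "weighted_walk q k (real l * q ^ i) x y"
  using assms(1)
proof (induction l arbitrary: y)
  case 0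
  then show ?case
    by (auto simp: weighted_walk_def intro: cost_walk_Nil)
next
  case (Suc l)
  then obtain z where "weighted_walk q k (real l * q ^ i) x z" "(z, y) \<in> parcs (diamond i)"
    by auto
  then have "weighted_walk q k (real l * q ^ i + q ^ i) x y"
    using weighted_walk_trans weighted_walk_arc assms(2) by blast
  then show ?case
    by (simp add: algebra_simps)
qed

text \<open>
  A vertex created at level \<open>i\<close> is adjacent, by a level-\<open>i\<close> edge, to a vertex of a lower level.
  Following such edges down to level \<open>n\<close> sums two geometric series along one descent: one in
  \<open>1/2\<close>, giving fewer than \<open>2 ^ j\<close> of the finest edges, and one in \<open>q\<close>.  The cost bound is
  written as the telescoped sum of \<open>q ^ i * (1 - q)\<close> over \<open>i\<close> from \<open>n\<close> to \<open>n + j - 1\<close>; charging a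
  level-\<open>i\<close> edge \<open>q ^ (i - 1)\<close> instead of \<open>q ^ i\<close> makes the constants simpler.
\<close>

lemma ancestor_vertex:
  assumes "x \<in> diamond_verts (n + j)" "0 < q" "q < 1"
  shows "\<exists>x' h c. x' \<in> diamond_verts n \<and> (x, x') \<in> parcs (diamond (n + j)) ^^ h \<and> h < 2 ^ j \<and>
    weighted_walk q (n + j) c x x' \<and> c * (1 - q) \<le> q ^ n - q ^ (n + j)"
  using assms(1)
proof (induction j arbitrary: x)
  case 0
  then show ?case
    by (intro exI[of _ x] exI[of _ 0]) (auto simp: weighted_walk_def intro: cost_walk_Nil)
next
  case (Suc j)
  let ?k = "n + j"
  obtain y h0 c0 where y: "y \<in> diamond_verts ?k"
    and h0: "(x, y) \<in> parcs (diamond (Suc ?k)) ^^ h0" "h0 \<le> 1"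
    and c0: "weighted_walk q (Suc ?k) c0 x y" "c0 \<le> q ^ ?k"
  proof (cases "x \<in> diamond_verts ?k")
    case True
    show ?thesis
      by (rule that[of x 0 0]) (use True \<open>0 < q\<close> in \<open>auto simp: weighted_walk_def intro: cost_walk_Nil\<close>)
  next
    case False
    then obtain u v b where uv: "(u, v) \<in> diamond_edges ?k" "x = Mid u v b"
      using Suc.prems by auto
    then have arc: "(x, u) \<in> parcs (diamond (Suc ?k))"
      using diamond_edges_Mid(1) unfolding parcs_diamond by blast
    show ?thesis
    proof (rule that[of u 1 "q ^ Suc ?k"])
      show "u \<in> diamond_verts ?k"
        using uv diamond_edges_verts by blast
      show "weighted_walk q (Suc ?k) (q ^ Suc ?k) x u"
        using arc by (rule weighted_walk_arc) simp
      show "q ^ Suc ?k \<le> q ^ ?k"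
        using assms by (simp add: mult_left_le_one_le)
    qed (use arc in auto)
  qed
  from Suc.IH[OF y] obtain x' h c where IH: "x' \<in> diamond_verts n"
      "(y, x') \<in> parcs (diamond ?k) ^^ h" "h < 2 ^ j"
      "weighted_walk q ?k c y x'" "c * (1 - q) \<le> q ^ n - q ^ ?k"
    by blast
  have "(x, x') \<in> parcs (diamond (Suc ?k)) ^^ (h0 + 2 * h)"
    using h0(1) relpow_diamond_refine[OF IH(2), of 1] relpow_trans by fastforce
  moreover have "h0 + 2 * h < 2 ^ Suc j"
    using h0(2) IH(3) by simp
  moreover have "weighted_walk q (Suc ?k) (c0 + c) x x'"
    using c0(1) weighted_walk_mono[OF IH(4)] weighted_walk_trans by fastforce
  moreover have "(c0 + c) * (1 - q) \<le> q ^ n - q ^ Suc ?k"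
  proof -
    have "c0 * (1 - q) \<le> q ^ ?k * (1 - q)"
      using c0(2) assms by (intro mult_right_mono) auto
    with IH(5) show ?thesis
      by (simp add: algebra_simps)
  qed
  ultimately show ?case
    using IH(1) by (auto intro!: exI[of _ x'] exI[of _ "h0 + 2 * h"] exI[of _ "c0 + c"] simp del: relpow.simps)
qed

lemma diamond_connected:
  assumes "x \<in> diamond_verts k" "y \<in> diamond_verts k"
  shows "\<exists>h. (x, y) \<in> parcs (diamond k) ^^ h"
proof -
  have root: "\<exists>r h. r \<in> diamond_verts 0 \<and> (z, r) \<in> parcs (diamond k) ^^ h" if "z \<in> diamond_verts k" for z
    using ancestor_vertex[where x = z and n = 0 and j = k and q = "1/2"] that by auto
  obtain x' h where x': "x' \<in> diamond_verts 0" "(x, x') \<in> parcs (diamond k) ^^ h"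
    using root[OF assms(1)] by blast
  obtain y' h' where y': "y' \<in> diamond_verts 0" "(y, y') \<in> parcs (diamond k) ^^ h'"
    using root[OF assms(2)] by blast
  obtain l where "(x', y') \<in> parcs (diamond 0) ^^ l"
  proof (cases "x' = y'")
    case False
    with x' y' have "(x', y') \<in> parcs (diamond 0) ^^ 1"
      by (auto simp: parcs_diamond)
    with that show ?thesis .
  qed (use that[of 0] in auto)
  from relpow_diamond_refine[OF this, of k]
  have "(x', y') \<in> parcs (diamond k) ^^ (2 ^ k * l)"
    by simp
  with x'(2) relpow_sym[OF sym_parcs_diamond y'(2)] show ?thesis
    by (blast intro: relpow_trans)
qed

section \<open>Comparison of the two metrics\<close>

text \<open>
  All edges have the same length, so the infimum of the walk lengths is attained.
\<close>

lemma diamond_dist_eq_hops: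
  assumes "x \<in> diamond_verts k" "y \<in> diamond_verts k"
  obtains h where "(x, y) \<in> parcs (diamond k) ^^ h" "diamond_dist k x y = real h * (1/2) ^ k"
    "\<And>h'. (x, y) \<in> parcs (diamond k) ^^ h' \<Longrightarrow> h \<le> h'"
proof -
  define h where "h = (LEAST h. (x, y) \<in> parcs (diamond k) ^^ h)"
  have h: "(x, y) \<in> parcs (diamond k) ^^ h"
    unfolding h_def using diamond_connected[OF assms] by (rule LeastI_ex)
  have least: "h \<le> h'" if "(x, y) \<in> parcs (diamond k) ^^ h'" for h'
    unfolding h_def using that by (rule Least_le)
  have walk: "cost_walk (parcs (diamond k)) (\<lambda>_. (1/2) ^ k) (real h * (1/2) ^ k) x y"
    using h by (auto simp: cost_walk_const)
  have "diamond_dist k x y \<le> real h * (1/2) ^ k"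
    unfolding diamond_dist_def
    by (rule pair_wf_digraph.graph_dist_lower[OF pair_wf_digraph_diamond _ walk]) (use assms in auto)
  moreover have "real h * (1/2) ^ k \<le> diamond_dist k x y"
    unfolding diamond_dist_def
    by (rule pair_wf_digraph.graph_dist_greatest[OF pair_wf_digraph_diamond _ walk])
      (use assms least in \<open>auto simp: cost_walk_const\<close>)
  ultimately show ?thesis
    using that h least by force
qed

lemma powr_subadditive:
  fixes a b \<alpha> :: real
  assumes "0 \<le> a" "0 \<le> b" "0 \<le> \<alpha>" "\<alpha> \<le> 1"
  shows "(a + b) powr \<alpha> \<le> a powr \<alpha> + b powr \<alpha>"
proof (cases "a + b = 0")
  case False
  define s where "s = a + b"
  have s: "0 < s"
    using False assms s_def by linarith
  have frac: "t / s \<le> (t / s) powr \<alpha>" if "0 \<le> t" "t \<le> s" for t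
    using powr_mono'[of \<alpha> 1 "t / s"] that s assms by simp
  (* Fractions of the total only grow when raised to a power at most 1. *)
  have "1 = a / s + b / s"
    using s by (simp add: s_def flip: add_divide_distrib)
  also have "\<dots> \<le> (a / s) powr \<alpha> + (b / s) powr \<alpha>"
    using assms by (intro add_mono frac) (auto simp: s_def)
  finally have "s powr \<alpha> * 1 \<le> s powr \<alpha> * ((a / s) powr \<alpha> + (b / s) powr \<alpha>)"
    by (intro mult_left_mono) auto
  then show ?thesis
    using s assms by (simp add: s_def powr_divide distrib_left)
qed (use assms in simp)

text \<open>
  Replace each level-\<open>i\<close> arc of the weighted walk by its subdivision into \<open>2 ^ (k - i)\<close> finest edges.
  The arc costs exactly the snowflaked length of its subdivision, and by subadditivity the
  snowflaked length of the concatenation is at most the sum of the costs.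
\<close>

lemma snowflake_lower:
  assumes "weighted_walk q k c x y" and q: "q = (1/2) powr \<alpha>" and \<alpha>: "0 \<le> \<alpha>" "\<alpha> \<le> 1"
  shows "\<exists>h. (x, y) \<in> parcs (diamond k) ^^ h \<and> (real h * (1/2) ^ k) powr \<alpha> \<le> c"
  using assms(1) unfolding weighted_walk_def
proof (induction rule: cost_walk.induct)
  case (cost_walk_Nil x)
  then show ?case
    by (auto intro!: exI[of _ 0])
next
  case (cost_walk_Cons x y c z)
  then obtain h where h: "(y, z) \<in> parcs (diamond k) ^^ h" "(real h * (1/2) ^ k) powr \<alpha> \<le> c"
    by blast
  from cost_walk_Cons.hyps(1) obtain i where i: "i \<le> k" "(x, y) \<in> parcs (diamond i)"
    by (auto simp: parcs_weighted_diamond)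
  have xy: "(x, y) \<in> parcs (diamond k) ^^ (2 ^ (k - i))"
    using relpow_diamond_refine[where n = i and h = 1 and j = "k - i"] i by simp
  have "real (2 ^ (k - i) + h) * (1/2) ^ k = (1/2) ^ i + real h * (1/2) ^ k"
  proof -
    have "(2::real) ^ k = 2 ^ i * 2 ^ (k - i)"
      using i by (simp flip: power_add)
    then show ?thesis
      by (simp add: field_simps)
  qed
  then have "(real (2 ^ (k - i) + h) * (1/2) ^ k) powr \<alpha> \<le> ((1/2) ^ i) powr \<alpha> + (real h * (1/2) ^ k) powr \<alpha>"
    using powr_subadditive[of "(1/2) ^ i" "real h * (1/2) ^ k" \<alpha>] \<alpha> by simp
  also have "((1/2::real) ^ i) powr \<alpha> = q ^ edge_level (x, y)"
    by (simp add: q edge_level_eq[OF i(2)] powr_power powr_powr mult.commute flip: powr_realpow)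
  finally show ?case
    using h relpow_trans[OF xy h(1)] by (intro exI[of _ "2 ^ (k - i) + h"]) auto
qed

text \<open>
  The walk leaves \<open>x\<close> for an ancestor at the scale \<open>n\<close> of the distance, crosses a bounded number of
  level-\<open>n\<close> edges, and comes back from an ancestor of \<open>y\<close>.
\<close>

lemma weighted_walk_upper:
  assumes x: "x \<in> diamond_verts k" and y: "y \<in> diamond_verts k"
    and walk: "(x, y) \<in> parcs (diamond k) ^^ h" and h: "0 < h"
    and q: "q = (1/2) powr \<alpha>" "0 < q" "q < 1" and \<alpha>: "0 \<le> \<alpha>"
  shows "\<exists>c. weighted_walk q k c x y \<and> c \<le> (3 + 2 / (1 - q)) * (real h * (1/2) ^ k) powr \<alpha>"
proof -
  (* At scale 0 the two level-0 vertices are adjacent, which replaces the bound on h there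
     and avoids computing the diameter. *)
  obtain n j where k: "k = n + j" and jh: "2 ^ j \<le> h" and hj: "n = 0 \<or> h < 2 ^ (j + 1)"
  proof -
    obtain i where i: "2 ^ i \<le> h" "h < 2 ^ (i + 1)"
      using ex_power_ivl1[of 2 h] h by auto
    show ?thesis
    proof (cases "i \<le> k")
      case True
      with i show ?thesis
        by (intro that[of "k - i" i]) auto
    next
      case False
      then have "(2::nat) ^ k \<le> 2 ^ i"
        by (intro power_increasing) auto
      then show ?thesis
        using i(1) by (intro that[of 0 k]) linarith+
    qed
  qed
  (* The telescoped bounds give at most q ^ n / (1 - q) for each of the two descents. *)
  obtain x' hx cx where x': "x' \<in> diamond_verts n" "(x, x') \<in> parcs (diamond k) ^^ hx" "hx < 2 ^ j"
      "weighted_walk q k cx x x'" "cx * (1 - q) \<le> q ^ n - q ^ k"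
    using ancestor_vertex[of x n j q] x q k by blast
  obtain y' hy cy where y': "y' \<in> diamond_verts n" "(y, y') \<in> parcs (diamond k) ^^ hy" "hy < 2 ^ j"
      "weighted_walk q k cy y y'" "cy * (1 - q) \<le> q ^ n - q ^ k"
    using ancestor_vertex[of y n j q] y q k by blast
  obtain l where l: "l \<le> 3" "(x', y') \<in> parcs (diamond n) ^^ l"
  proof (cases "n = 0")
    case True
    show ?thesis
    proof (cases "x' = y'")
      case False
      with True x'(1) y'(1) have "(x', y') \<in> parcs (diamond n) ^^ 1"
        by (auto simp: parcs_diamond)
      from that[OF _ this] show ?thesis
        by simp
    qed (use that[of 0] in auto)
  next
    case False
    have "(x', y') \<in> parcs (diamond (n + j)) ^^ (hx + h + hy)"
      using relpow_sym[OF sym_parcs_diamond x'(2)] walk y'(2) k by (blast intro: relpow_trans)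
    then obtain l where l: "2 ^ j * l \<le> hx + h + hy" "(x', y') \<in> parcs (diamond n) ^^ l"
      using relpow_diamond_fold x'(1) y'(1) by blast
    have "hx + h + hy < 2 ^ j * 4"
      using x'(3) y'(3) hj False by simp
    with l(1) have "2 ^ j * l < 2 ^ j * 4"
      by (rule le_less_trans)
    then have "l < 4"
      by (simp only: mult_less_cancel1)
    with l(2) show ?thesis
      by (intro that) auto
  qed
  have "weighted_walk q k (cx + real l * q ^ n + cy) x y"
    using x'(4) weighted_walk_relpow[OF l(2), of k q] weighted_walk_sym[OF y'(4)] k
    by (auto intro: weighted_walk_trans)
  moreover have "cx + real l * q ^ n + cy \<le> (3 + 2 / (1 - q)) * (real h * (1/2) ^ k) powr \<alpha>"
  proof -
    have "c \<le> q ^ n / (1 - q)" if "c * (1 - q) \<le> q ^ n - q ^ k" for c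
    proof -
      have "c * (1 - q) \<le> q ^ n"
        using that zero_less_power[of q k] q by linarith
      then show ?thesis
        using q by (simp add: pos_le_divide_eq)
    qed
    from this[OF x'(5)] this[OF y'(5)] have "cx \<le> q ^ n / (1 - q)" "cy \<le> q ^ n / (1 - q)" .
    moreover have "real l * q ^ n \<le> 3 * q ^ n"
      using l(1) q by (intro mult_right_mono) auto
    ultimately have "cx + real l * q ^ n + cy \<le> (3 + 2 / (1 - q)) * q ^ n"
      by (simp add: algebra_simps)
    also have "q ^ n \<le> (real h * (1/2) ^ k) powr \<alpha>"
    proof -
      have "q ^ n = ((1/2) ^ n) powr \<alpha>"
        by (simp add: q(1) powr_power powr_powr mult.commute flip: powr_realpow)
      also have "(1/2::real) ^ n = real (2 ^ j) * (1/2) ^ k"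
        by (simp add: k power_add field_simps)
      also have "(real (2 ^ j) * (1/2) ^ k) powr \<alpha> \<le> (real h * (1/2) ^ k) powr \<alpha>"
        using jh \<alpha> by (intro powr_mono2 mult_right_mono) (auto simp flip: of_nat_power)
      finally show ?thesis .
    qed
    then have "(3 + 2 / (1 - q)) * q ^ n \<le> (3 + 2 / (1 - q)) * (real h * (1/2) ^ k) powr \<alpha>"
      using q by (intro mult_left_mono) auto
    finally show ?thesis .
  qed
  ultimately show ?thesis
    by blast
qed

lemma weighted_diamond_dist_bounds:
  fixes \<epsilon> \<alpha> :: real
  defines "q \<equiv> 1/2 + \<epsilon>"
  assumes x: "x \<in> diamond_verts k" and y: "y \<in> diamond_verts k" and "x \<noteq> y"
    and q: "q = (1/2) powr \<alpha>" "0 < q" "q < 1" and \<alpha>: "0 \<le> \<alpha>" "\<alpha> \<le> 1"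
  shows "0 < diamond_dist k x y"
    and "diamond_dist k x y powr \<alpha> \<le> weighted_diamond_dist \<epsilon> k x y"
    and "weighted_diamond_dist \<epsilon> k x y \<le> (3 + 2 / (1 - q)) * diamond_dist k x y powr \<alpha>"
proof -
  obtain h where h: "(x, y) \<in> parcs (diamond k) ^^ h" "diamond_dist k x y = real h * (1/2) ^ k"
      "\<And>h'. (x, y) \<in> parcs (diamond k) ^^ h' \<Longrightarrow> h \<le> h'"
    using diamond_dist_eq_hops[OF x y] by blast
  have h0: "0 < h"
    using h(1) \<open>x \<noteq> y\<close> by (cases h) auto
  then show "0 < diamond_dist k x y"
    by (simp add: h(2))
  obtain c where c: "weighted_walk q k c x y"
      "c \<le> (3 + 2 / (1 - q)) * (real h * (1/2) ^ k) powr \<alpha>"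
    using weighted_walk_upper[OF x y h(1) h0 q \<alpha>(1)] by blast
  note W = c(1)[unfolded weighted_walk_def]
  show "weighted_diamond_dist \<epsilon> k x y \<le> (3 + 2 / (1 - q)) * diamond_dist k x y powr \<alpha>"
  proof -
    have "weighted_diamond_dist \<epsilon> k x y \<le> c"
      unfolding weighted_diamond_dist_def q_def[symmetric]
      by (rule pair_wf_digraph.graph_dist_lower[OF pair_wf_digraph_weighted_diamond _ W])
        (use x q in auto)
    with c(2) show ?thesis
      by (simp add: h(2))
  qed
  show "diamond_dist k x y powr \<alpha> \<le> weighted_diamond_dist \<epsilon> k x y"
    unfolding weighted_diamond_dist_def q_def[symmetric]
  proof (rule pair_wf_digraph.graph_dist_greatest[OF pair_wf_digraph_weighted_diamond _ W])
    fix c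
    assume "cost_walk (parcs (weighted_diamond k)) (\<lambda>e. q ^ edge_level e) c x y"
    then obtain h' where h': "(x, y) \<in> parcs (diamond k) ^^ h'" "(real h' * (1/2) ^ k) powr \<alpha> \<le> c"
      using snowflake_lower[of q k c x y \<alpha>] q \<alpha> by (auto simp: weighted_walk_def)
    have "diamond_dist k x y powr \<alpha> \<le> (real h' * (1/2) ^ k) powr \<alpha>"
      unfolding h(2) using h(3)[OF h'(1)] \<alpha> by (intro powr_mono2 mult_right_mono) auto
    with h'(2) show "diamond_dist k x y powr \<alpha> \<le> c"
      by simp
  qed (use x in simp)
qed

text \<open>
  Positivity of \<open>e\<close>, and hence of \<open>d\<close>, keeps both quotients away from division by zero.
\<close>

lemma distortion_id_le:
  assumes "\<And>x y. x \<in> X \<Longrightarrow> y \<in> X \<Longrightarrow> x \<noteq> y \<Longrightarrow> 0 < e x y \<and> e x y \<le> d x y \<and> d x y \<le> C * e x y"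
  shows "distortion X d e id \<le> ennreal C"
proof -
  have "(SUP (x, y)\<in>{(x, y). x \<in> X \<and> y \<in> X \<and> x \<noteq> y}. ennreal (e (id x) (id y)) / ennreal (d x y)) \<le> 1"
  proof (rule SUP_least, clarify)
    fix x y assume "x \<in> X" "y \<in> X" "x \<noteq> y"
    then have "0 < e x y" "e x y \<le> d x y"
      using assms by auto
    then show "ennreal (e (id x) (id y)) / ennreal (d x y) \<le> 1"
      by (simp add: divide_ennreal flip: ennreal_1 del: ennreal_1)
  qed
  moreover have "(SUP (x, y)\<in>{(x, y). x \<in> X \<and> y \<in> X \<and> x \<noteq> y}. ennreal (d x y) / ennreal (e (id x) (id y))) \<le> ennreal C"
  proof (rule SUP_least, clarify)
    fix x y assume "x \<in> X" "y \<in> X" "x \<noteq> y"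
    then have "0 < e x y" "e x y \<le> d x y" "d x y \<le> C * e x y"
      using assms by auto
    then show "ennreal (d x y) / ennreal (e (id x) (id y)) \<le> ennreal C"
      by (simp add: divide_ennreal pos_divide_le_eq ennreal_leI)
  qed
  ultimately show ?thesis
    unfolding distortion_def by (rule order_trans[OF mult_mono]) auto
qed

theorem proposition3p6:
  fixes \<epsilon> :: real
  assumes "0 < \<epsilon>" and "\<epsilon> < 1/2"
  shows "\<exists>\<alpha> K :: real. 0 < \<alpha> \<and> \<alpha> < 1 \<and>
    (\<forall>k :: nat. distortion (pverts (weighted_diamond k))
        (weighted_diamond_dist \<epsilon> k) (snowflake \<alpha> (diamond_dist k)) id \<le> ennreal K)"
proof -
  define q where "q = 1/2 + \<epsilon>"
  define \<alpha> where "\<alpha> = log (1/2) q"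
  have q: "1/2 < q" "q < 1"
    using assms by (auto simp: q_def)
  have "q = (1/2) powr \<alpha>"
    using q by (simp add: \<alpha>_def)
  have \<alpha>: "0 < \<alpha>" "\<alpha> < 1"
  proof -
    show "0 < \<alpha>"
      using powr_mono'[of \<alpha> 0 "1/2"] q \<open>q = (1/2) powr \<alpha>\<close> by (cases "0 < \<alpha>") auto
    show "\<alpha> < 1"
      using powr_mono'[of 1 \<alpha> "1/2"] q \<open>q = (1/2) powr \<alpha>\<close> by (cases "\<alpha> < 1") auto
  qed
  have "distortion (pverts (weighted_diamond k)) (weighted_diamond_dist \<epsilon> k)
      (snowflake \<alpha> (diamond_dist k)) id \<le> ennreal (3 + 2 / (1 - q))" for k
  proof (rule distortion_id_le)
    fix x y
    assume "x \<in> pverts (weighted_diamond k)" "y \<in> pverts (weighted_diamond k)" "x \<noteq> y"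
    then show "0 < snowflake \<alpha> (diamond_dist k) x y \<and>
        snowflake \<alpha> (diamond_dist k) x y \<le> weighted_diamond_dist \<epsilon> k x y \<and>
        weighted_diamond_dist \<epsilon> k x y \<le> (3 + 2 / (1 - q)) * snowflake \<alpha> (diamond_dist k) x y"
      using weighted_diamond_dist_bounds[of x k y \<epsilon> \<alpha>] q \<alpha> \<open>q = (1/2) powr \<alpha>\<close>
      by (auto simp: snowflake_def q_def)
  qed
  with \<alpha> show ?thesis
    by blast
qed

end
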